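(* Let $N\ge 1$ and let $E:\mathbb{R}^N\to\mathbb{R}$ be strictly convex and twice continuously differentiable, with positive definite Hessian $W(x):=\partial_x^2E(x)$ at every $x\in\mathbb{R}^N$. Let $\Delta:\mathbb{R}^N\to(0,\infty)$ be a function and put $$\mathbb{U}(x):=\{u\in\mathbb{R}^N:\ \langle u, W(x)u\rangle\le\Delta(x)\}.$$ Let $n_1,\dots,n_m\ge1$ be integers with $\sum_{i=1}^m n_i=N$, write $\lambda\in\mathbb{R}^N$ in consecutive blocks as $\lambda=(\lambda^{n_1},\dots,\lambda^{n_m})$ with $i$-th block $\lambda^{n_i}\in\mathbb{R}^{n_i}$, let $Q^i$ be a symmetric positive definite $n_i\times n_i$ matrix for each $i$, let $Q:=\mathrm{diag}(Q^1,\dots,Q^m)$ (block diagonal), and let $$V^B_i(\lambda):=\tfrac12\langle\lambda^{n_i},Q^i\lambda^{n_i}\rangle,\qquad V^B(\lambda):=\max_{1\le i\le m}V^B_i(\lambda).$$ Then the maximum principle with $V=V^B$ generates the block coordinate descent algorithm, in the following sense. Let $\nu_0>0$, let $(h_k)_{k\ge 0}$ be positive reals, and let $(x_k)_{k\ge0}$ in $\mathbb{R}^N$ satisfy $x_{k+1}=x_k+h_ku_k$, where, for each $k$ with $\partial_xE(x_k)\neq 0$, $u_k$ is a solution of $$\text{Maximize}_{u\in\mathbb{U}(x_k)}\ \langle \xi_k,\ \partial_x^2E(x_k)\,u\rangle ,$$ with $\lambda_k:=-\nu_0\,\partial_xE(x_k)$ and $\xi_k\in\partial V^B(\lambda_k)$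 the unbiased subgradient of $V^B$ at $\lambda_k$. Then for every $k$ with $\partial_xE(x_k)\neq0$ there is a step size $\alpha_k>0$ such that $$x_{k+1}=x_k-\alpha_k\, q\circ \big(Q\,\partial_xE(x_k)\big),$$ where $q=q(\lambda_k)$.
   Context: $\partial_xE$ and $\partial_x^2E$ denote the gradient and Hessian of $E$; $\langle\cdot,\cdot\rangle$ is the Euclidean inner product and $\circ$ is the Hadamard (componentwise) product of vectors. For $\lambda\in\mathbb{R}^N$, the vector $q(\lambda)\in\{0,1\}^N$ is defined blockwise: its $i$-th block (of length $n_i$) is the vector of $n_i$ ones if $V^B_i(\lambda)=\max_jV^B_j(\lambda)$, and is the zero vector otherwise. $\partial V^B(\lambda)$ is the (convex) subdifferential of $V^B$ at $\lambda$; explicitly, it is the convex hull of the gradients $(0,\dots,Q^i\lambda^{n_i},\dots,0)$ of $V^B_i$ over those $i$ with $V^B_i(\lambda)=V^B(\lambda)$. The unbiased subgradient of $V^B$ at $\lambda\neq0$ is the vector $\gamma\,q(\lambda)\circ(Q\lambda)$, where $\gamma>0$ is chosen so that this vector lies in $\partial V^B(\lambda)$. Background meaning of the maximum principle: to minimize $E$ one considers a trajectory $\dot x=u$ with costate $\lambda=-\nu_0\,\partial_xE(x)$, $\nu_0>0$, so that $\dot\lambda=-\nu_0\,\partial_x^2E(x)u$. Given a positive definite function $V$ of $\lambda$ (a candidate control Lyapunov function) and a compact control set $\mathbb{U}$, the maximum principle selects the control $u\in\mathbb{U}$ maximizing $\langle\xi,\partial_x^2E(x)u\rangle$ for a subgradient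 $\xi\in\partial V(\lambda)$. The algorithm is the forward Euler discretization $x_{k+1}=x_k+h_ku_k$, $h_k>0$. *)

theory Defs
  imports "HOL-Analysis.Analysis"
begin

section \<open>Smooth and convex functions\<close>

definition gradient :: "('a::real_inner \<Rightarrow> real) \<Rightarrow> 'a \<Rightarrow> 'a" where
  "gradient f x = (THE D. GDERIV f x :> D)"

definition hessian :: "(real^'n \<Rightarrow> real) \<Rightarrow> real^'n \<Rightarrow> real^'n^'n" where
  "hessian f x = jacobian (gradient f) (at x)"

definition twice_continuously_differentiable :: "(real^'n \<Rightarrow> real) \<Rightarrow> bool" where
  "twice_continuously_differentiable f \<longleftrightarrow>
     (\<forall>x. f differentiable (at x)) \<and> (\<forall>x. gradient f differentiable (at x)) \<and>
     continuous_on UNIV (hessian f)"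

definition strictly_convex_on :: "'a::real_vector set \<Rightarrow> ('a \<Rightarrow> real) \<Rightarrow> bool" where
  "strictly_convex_on S f \<longleftrightarrow> convex S \<and>
     (\<forall>x\<in>S. \<forall>y\<in>S. \<forall>u>0. \<forall>v>0. x \<noteq> y \<longrightarrow> u + v = 1 \<longrightarrow>
        f (u *\<^sub>R x + v *\<^sub>R y) < u * f x + v * f y)"

definition pos_def_matrix :: "real^'n^'n \<Rightarrow> bool" where
  "pos_def_matrix A \<longleftrightarrow> (\<forall>v. v \<noteq> 0 \<longrightarrow> 0 < v \<bullet> (A *v v))"

definition subdifferential :: "('a::real_inner \<Rightarrow> real) \<Rightarrow> 'a \<Rightarrow> 'a set" where
  "subdifferential f x = {g. \<forall>y. f x + g \<bullet> (y - x) \<le> f y}"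

section \<open>Block structure\<close>

text \<open>
  The block sizes \<open>n\<^sub>1, \<dots>, n\<^sub>m\<close> form a list \<open>ns\<close> with \<open>sum_list ns = CARD('n)\<close>, and
  the blocks are consecutive for the linear order of the index type. Blocks, positions
  in a block and positions in the whole vector are counted from 0.
\<close>

definition position :: "'n::{finite,linorder} \<Rightarrow> nat" where
  "position c = card {..<c}"

definition offset :: "nat list \<Rightarrow> nat \<Rightarrow> nat" where
  "offset ns i = sum_list (take i ns)"

definition coord :: "nat list \<Rightarrow> nat \<Rightarrow> nat \<Rightarrow> 'n::{finite,linorder}" where
  "coord ns i j = sorted_list_of_set UNIV ! (offset ns i + j)"

definition block_of :: "nat list \<Rightarrow> 'n::{finite,linorder} \<Rightarrow> nat" where
  "block_of ns c = (LEAST i. position c < offset ns (Suc i))"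

definition index_in_block :: "nat list \<Rightarrow> 'n::{finite,linorder} \<Rightarrow> nat" where
  "index_in_block ns c = position c - offset ns (block_of ns c)"

text \<open>
  \<open>coord ns\<close> is the inverse of \<open>c \<mapsto> (block_of ns c, index_in_block ns c)\<close>.
\<close>

lemma position_nth:
  assumes "p < CARD('n::{finite,linorder})"
  shows "position (sorted_list_of_set (UNIV :: 'n set) ! p) = p"
proof -
  let ?xs = "sorted_list_of_set (UNIV :: 'n set)"
  have len: "length ?xs = CARD('n)" by simp
  have sd: "sorted_wrt (<) ?xs" by simp
  have "{..< ?xs ! p} = (\<lambda>q. ?xs ! q) ` {..<p}"
  proof (intro equalityI subsetI)
    fix c assume c: "c \<in> {..< ?xs ! p}"
    have "c \<in> set ?xs" by simp
    then obtain q where q: "q < length ?xs" "c = ?xs ! q" by (metis in_set_conv_nth)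
    have "q < p"
    proof (rule ccontr)
      assume "\<not> q < p"
      then have "?xs ! p \<le> ?xs ! q"
        using q len by (metis linorder_not_less sorted_list_of_set(2) sorted_nth_mono)
      with c q show False by auto
    qed
    with q show "c \<in> (\<lambda>q. ?xs ! q) ` {..<p}" by auto
  next
    fix c assume "c \<in> (\<lambda>q. ?xs ! q) ` {..<p}"
    then show "c \<in> {..< ?xs ! p}"
      using sorted_wrt_nth_less[OF sd] assms len by auto
  qed
  moreover have "inj_on (\<lambda>q. ?xs ! q) {..<p}"
    using assms len by (auto simp: inj_on_def nth_eq_iff_index_eq)
  ultimately show ?thesis by (simp add: position_def card_image)
qed

lemma offset_mono: "i \<le> j \<Longrightarrow> offset ns i \<le> offset ns j"
  by (metis add_leE le_add1 le_add_diff_inverse offset_def sum_list.append take_add)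

lemma offset_Suc: "i < length ns \<Longrightarrow> offset ns (Suc i) = offset ns i + ns ! i"
  by (simp add: offset_def take_Suc_conv_app_nth)

lemma block_coord:
  assumes "sum_list ns = CARD('n::{finite,linorder})" "i < length ns" "j < ns ! i"
  shows "block_of ns (coord ns i j :: 'n) = i" "index_in_block ns (coord ns i j :: 'n) = j"
proof -
  have "offset ns (Suc i) \<le> offset ns (length ns)"
    using assms(2) by (intro offset_mono) simp
  then have "offset ns i + j < CARD('n)"
    using assms by (simp add: offset_Suc) (simp add: offset_def)
  then have p: "position (coord ns i j :: 'n) = offset ns i + j"
    by (simp add: coord_def position_nth)
  show b: "block_of ns (coord ns i j :: 'n) = i"
    unfolding block_of_def p
  proof (rule Least_equality)
    show "offset ns i + j < offset ns (Suc i)" using assms by (simp add: offset_Suc)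
  next
    fix k assume "offset ns i + j < offset ns (Suc k)"
    then show "i \<le> k"
      using offset_mono[of "Suc k" i ns] by (cases "i \<le> k") auto
  qed
  show "index_in_block ns (coord ns i j :: 'n) = j"
    by (simp add: index_in_block_def b p)
qed

section \<open>Block quadratic forms\<close>

text \<open>
  An \<open>n \<times> n\<close> matrix is a function \<open>nat \<Rightarrow> nat \<Rightarrow> real\<close> of which only the entries at
  indices below \<open>n\<close> matter.
\<close>

definition sym_pos_def :: "nat \<Rightarrow> (nat \<Rightarrow> nat \<Rightarrow> real) \<Rightarrow> bool" where
  "sym_pos_def n A \<longleftrightarrow>
     (\<forall>j<n. \<forall>k<n. A j k = A k j) \<and>
     (\<forall>v. (\<exists>j<n. v j \<noteq> 0) \<longrightarrow> 0 < (\<Sum>j<n. \<Sum>k<n. v j * A j k * v k))"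

definition block_diag ::
  "nat list \<Rightarrow> (nat \<Rightarrow> nat \<Rightarrow> nat \<Rightarrow> real) \<Rightarrow> real^'n::{finite,linorder}^'n::{finite,linorder}" where
  "block_diag ns Q = (\<chi> c d. if block_of ns c = block_of ns d
     then Q (block_of ns c) (index_in_block ns c) (index_in_block ns d) else 0)"

definition V_block ::
  "nat list \<Rightarrow> (nat \<Rightarrow> nat \<Rightarrow> nat \<Rightarrow> real) \<Rightarrow> nat \<Rightarrow> real^'n::{finite,linorder} \<Rightarrow> real" where
  "V_block ns Q i l = 1/2 * (\<Sum>j<ns!i. \<Sum>k<ns!i. l $ coord ns i j * Q i j k * l $ coord ns i k)"

definition V_max ::
  "nat list \<Rightarrow> (nat \<Rightarrow> nat \<Rightarrow> nat \<Rightarrow> real) \<Rightarrow> real^'n::{finite,linorder} \<Rightarrow> real" where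
  "V_max ns Q l = Max ((\<lambda>i. V_block ns Q i l) ` {..<length ns})"

definition q_vec ::
  "nat list \<Rightarrow> (nat \<Rightarrow> nat \<Rightarrow> nat \<Rightarrow> real) \<Rightarrow> real^'n::{finite,linorder} \<Rightarrow> real^'n::{finite,linorder}" where
  "q_vec ns Q l = (\<chi> c. if V_block ns Q (block_of ns c) l = V_max ns Q l then 1 else 0)"

text \<open>The product \<open>*\<close> on \<open>real^'n\<close> is the Hadamard product.\<close>

definition unbiased_subgradient ::
  "nat list \<Rightarrow> (nat \<Rightarrow> nat \<Rightarrow> nat \<Rightarrow> real) \<Rightarrow> real^'n::{finite,linorder} \<Rightarrow> real^'n::{finite,linorder} \<Rightarrow> bool" where
  "unbiased_subgradient ns Q l \<xi> \<longleftrightarrow> l \<noteq> 0 \<and> \<xi> \<in> subdifferential (V_max ns Q) l \<and>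
     (\<exists>\<gamma>>0. \<xi> = \<gamma> *\<^sub>R (q_vec ns Q l * (block_diag ns Q *v l)))"

definition control_set ::
  "(real^'n \<Rightarrow> real) \<Rightarrow> (real^'n \<Rightarrow> real) \<Rightarrow> real^'n \<Rightarrow> (real^'n) set" where
  "control_set E \<Delta> x = {u. u \<bullet> (hessian E x *v u) \<le> \<Delta> x}"

end

theory Submission
  imports Defs
begin

text \<open>
  Write \<open>W\<close> for the Hessian of \<open>E\<close> at \<open>x\<^sub>k\<close>. It is symmetric, because \<open>E\<close> is twice
  differentiable, and positive definite by assumption, so \<open>\<langle>u, W u\<rangle>\<close> is the square of a norm
  whose inner product is \<open>\<langle>\<xi>, W u\<rangle>\<close>. The maximum principle therefore maximizes a linear
  functional, represented by \<open>\<xi>\<close> in this inner product, over a ball around the origin. The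
  unique maximizer is a positive multiple of \<open>\<xi>\<close>, provided that \<open>\<xi> \<noteq> 0\<close>
  (\<open>arg_max_on_ellipsoid\<close>): the matrix \<open>W\<close> cancels, and the step goes along \<open>\<xi>\<close> itself.

  The subgradient \<open>\<xi>\<close> does not vanish, because the maximum \<open>V\<close> of the block forms is positive
  away from the origin and vanishes there, whereas \<open>0 \<in> \<partial>V(\<lambda>)\<close> would make \<open>\<lambda>\<close> a global minimizer
  (\<open>unbiased_subgradient_nonzero\<close>). Since \<open>\<xi>\<close> is a positive multiple of \<open>q \<circ> (Q \<lambda>)\<close> and \<open>\<lambda>\<close> is a
  negative multiple of the gradient of \<open>E\<close>, the step is a block coordinate descent step.

  The symmetry of \<open>W\<close> is essential: without it the maximizer would be a multiple of
  \<open>S\<^sup>-\<^sup>1 W\<^sup>T \<xi>\<close> with \<open>S\<close> the symmetric part of \<open>W\<close>. It is proved here by the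
  second-difference argument (\<open>symmetric_second_derivative\<close>).
\<close>

section \<open>Symmetry of the Hessian\<close>

text \<open>
  The second difference of \<open>f\<close> over the parallelogram with sides \<open>t a\<close> and \<open>t b\<close> is
  \<open>t\<^sup>2 \<langle>a, D b\<rangle> + o(t\<^sup>2)\<close>, by the mean value theorem along \<open>a\<close> and differentiability of
  the gradient at the single point \<open>x\<close>.
\<close>

lemma second_difference_approx:
  fixes f :: "'a::real_inner \<Rightarrow> real"
  assumes f: "\<And>y. GDERIV f y :> g y"
    and g: "(g has_derivative D) (at x)"
    and "0 < e"
  shows "\<exists>d>0. \<forall>t. 0 < t \<and> t < d \<longrightarrow>
    \<bar>f (x + t *\<^sub>R a + t *\<^sub>R b) - f (x + t *\<^sub>R a) - f (x + t *\<^sub>R b) + f x - t\<^sup>2 * (a \<bullet> D b)\<bar> \<le> e * t\<^sup>2"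
proof -
  define M where "M = norm a + norm b + 1"
  have M: "0 < M" "norm a + norm b \<le> M" "norm a \<le> M"
    unfolding M_def by (auto intro: add_nonneg_pos)
  \<comment> \<open>chosen so that the two remainder terms, each paired with \<open>a\<close>, add up to at most \<open>e t\<close>\<close>
  define e' where "e' = e / (2 * M\<^sup>2)"
  have e': "0 < e'" using M \<open>0 < e\<close> by (simp add: e'_def)
  interpret D: bounded_linear D using g by (rule has_derivative_bounded_linear)
  obtain d where "0 < d"
    and d: "\<And>y. norm (y - x) < d \<Longrightarrow> norm (g y - g x - D (y - x)) \<le> e' * norm (y - x)"
    using g e' unfolding has_derivative_at_alt by meson
  show ?thesis
  proof (intro exI[of _ "d / M"] conjI allI impI)
    show "0 < d / M" using \<open>0 < d\<close> M by simp
  next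
    fix t assume "0 < t \<and> t < d / M"
    then have t: "0 < t" "t * M < d" using M by (auto simp: field_simps)
    have near: "norm (g (x + v) - g x - D v) \<le> e' * (t * M)" if "norm v \<le> t * M" for v
    proof -
      have "norm (g (x + v) - g x - D v) \<le> e' * norm v"
        using d[of "x + v"] that t by simp
      also have "\<dots> \<le> e' * (t * M)" using that e' by simp
      finally show ?thesis .
    qed
    let ?\<phi> = "\<lambda>s. f (x + s *\<^sub>R a + t *\<^sub>R b) - f (x + s *\<^sub>R a)"
    have der: "(?\<phi> has_derivative
        (\<lambda>r. r * (a \<bullet> (g (x + s *\<^sub>R a + t *\<^sub>R b) - g (x + s *\<^sub>R a))))) (at s)" for s
    proof -
      have fd: "(f has_derivative (\<lambda>k. k \<bullet> g y)) (at y)" for y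
        using f[of y] by (simp add: gderiv_def)
      have "((\<lambda>s. f (x + s *\<^sub>R a + t *\<^sub>R b)) has_derivative
          (\<lambda>r. (r *\<^sub>R a) \<bullet> g (x + s *\<^sub>R a + t *\<^sub>R b))) (at s)"
        by (rule has_derivative_compose[OF _ fd]) (auto intro!: derivative_eq_intros)
      moreover have "((\<lambda>s. f (x + s *\<^sub>R a)) has_derivative
          (\<lambda>r. (r *\<^sub>R a) \<bullet> g (x + s *\<^sub>R a))) (at s)"
        by (rule has_derivative_compose[OF _ fd]) (auto intro!: derivative_eq_intros)
      ultimately have "(?\<phi> has_derivative (\<lambda>r. (r *\<^sub>R a) \<bullet> g (x + s *\<^sub>R a + t *\<^sub>R b)
          - (r *\<^sub>R a) \<bullet> g (x + s *\<^sub>R a))) (at s)"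
        by (rule has_derivative_diff)
      then show ?thesis by (simp add: inner_diff_right right_diff_distrib)
    qed
    obtain s where s: "0 < s" "s < t"
      and mv: "?\<phi> t - ?\<phi> 0 = (t - 0) * (a \<bullet> (g (x + s *\<^sub>R a + t *\<^sub>R b) - g (x + s *\<^sub>R a)))"
      using mvt_simple[OF \<open>0 < t\<close> has_derivative_at_withinI[OF der]] by auto
    let ?r = "g (x + s *\<^sub>R a + t *\<^sub>R b) - g (x + s *\<^sub>R a) - t *\<^sub>R D b"
    have sa: "norm (s *\<^sub>R a) \<le> t * norm a" using s by (simp add: mult_right_mono)
    have "norm (s *\<^sub>R a + t *\<^sub>R b) \<le> t * norm a + t * norm b"
      using norm_triangle_ineq[of "s *\<^sub>R a" "t *\<^sub>R b"] sa t by simp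
    also have "\<dots> \<le> t * M"
      using M t by (metis distrib_left less_imp_le mult_left_mono)
    finally have 1: "norm (s *\<^sub>R a + t *\<^sub>R b) \<le> t * M" .
    have 2: "norm (s *\<^sub>R a) \<le> t * M"
      using sa M t by (meson less_imp_le mult_left_mono order_trans)
    have "?r = (g (x + (s *\<^sub>R a + t *\<^sub>R b)) - g x - D (s *\<^sub>R a + t *\<^sub>R b))
        - (g (x + s *\<^sub>R a) - g x - D (s *\<^sub>R a))"
      by (simp add: D.add D.scaleR algebra_simps)
    then have "norm ?r \<le> norm (g (x + (s *\<^sub>R a + t *\<^sub>R b)) - g x - D (s *\<^sub>R a + t *\<^sub>R b))
        + norm (g (x + s *\<^sub>R a) - g x - D (s *\<^sub>R a))"
      by (simp only: norm_triangle_ineq4)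
    also have "\<dots> \<le> 2 * e' * (t * M)"
      using near[OF 1] near[OF 2] by linarith
    finally have r: "norm ?r \<le> 2 * e' * (t * M)" .
    have "\<bar>a \<bullet> ?r\<bar> \<le> norm a * norm ?r"
      by (rule Cauchy_Schwarz_ineq2)
    also have "\<dots> \<le> M * (2 * e' * (t * M))"
      using r M by (intro mult_mono) auto
    also have "\<dots> = e * t"
      using M by (simp add: e'_def power2_eq_square)
    finally have "t * \<bar>a \<bullet> ?r\<bar> \<le> t * (e * t)" using t by simp
    moreover have "f (x + t *\<^sub>R a + t *\<^sub>R b) - f (x + t *\<^sub>R a) - f (x + t *\<^sub>R b) + f x
        - t\<^sup>2 * (a \<bullet> D b) = t * (a \<bullet> ?r)"
      using mv by (simp add: inner_diff_right algebra_simps power2_eq_square)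
    ultimately show "\<bar>f (x + t *\<^sub>R a + t *\<^sub>R b) - f (x + t *\<^sub>R a) - f (x + t *\<^sub>R b) + f x
        - t\<^sup>2 * (a \<bullet> D b)\<bar> \<le> e * t\<^sup>2"
      using t by (simp add: abs_mult power2_eq_square mult_ac)
  qed
qed

lemma symmetric_second_derivative:
  fixes f :: "'a::real_inner \<Rightarrow> real"
  assumes "\<And>y. GDERIV f y :> g y" "(g has_derivative D) (at x)"
  shows "a \<bullet> D b = b \<bullet> D a"
proof -
  have "\<bar>a \<bullet> D b - b \<bullet> D a\<bar> \<le> e" if "0 < e" for e
  proof -
    have "0 < e / 2" using that by simp
    obtain d1 where d1: "0 < d1" "\<And>t. 0 < t \<Longrightarrow> t < d1 \<Longrightarrow>
        \<bar>f (x + t *\<^sub>R a + t *\<^sub>R b) - f (x + t *\<^sub>R a) - f (x + t *\<^sub>R b) + f x - t\<^sup>2 * (a \<bullet> D b)\<bar>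
          \<le> e / 2 * t\<^sup>2"
      using second_difference_approx[OF assms \<open>0 < e / 2\<close>, of a b] by blast
    obtain d2 where d2: "0 < d2" "\<And>t. 0 < t \<Longrightarrow> t < d2 \<Longrightarrow>
        \<bar>f (x + t *\<^sub>R b + t *\<^sub>R a) - f (x + t *\<^sub>R b) - f (x + t *\<^sub>R a) + f x - t\<^sup>2 * (b \<bullet> D a)\<bar>
          \<le> e / 2 * t\<^sup>2"
      using second_difference_approx[OF assms \<open>0 < e / 2\<close>, of b a] by blast
    obtain t where t: "0 < t" "t < d1" "t < d2"
      using d1(1) d2(1) by (metis field_lbound_gt_zero)
    have swap: "x + t *\<^sub>R b + t *\<^sub>R a = x + t *\<^sub>R a + t *\<^sub>R b" by (simp add: add_ac)
    have "\<bar>t\<^sup>2 * (a \<bullet> D b) - t\<^sup>2 * (b \<bullet> D a)\<bar> \<le> e * t\<^sup>2"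
      using d1(2)[OF t(1,2)] d2(2)[OF t(1,3), unfolded swap] by linarith
    moreover have "\<bar>t\<^sup>2 * (a \<bullet> D b) - t\<^sup>2 * (b \<bullet> D a)\<bar> = t\<^sup>2 * \<bar>a \<bullet> D b - b \<bullet> D a\<bar>"
      by (simp add: abs_mult flip: right_diff_distrib)
    ultimately have "t\<^sup>2 * \<bar>a \<bullet> D b - b \<bullet> D a\<bar> \<le> t\<^sup>2 * e"
      by (simp add: mult.commute)
    then show ?thesis using t by simp
  qed
  then have "\<bar>a \<bullet> D b - b \<bullet> D a\<bar> \<le> 0" by (rule field_le_epsilon[of _ 0, simplified])
  then show ?thesis by simp
qed

lemma gderiv_gradient:
  fixes f :: "real^'n \<Rightarrow> real"
  assumes "f differentiable (at x)"
  shows "GDERIV f x :> gradient f x"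
proof -
  obtain D where D: "(f has_derivative D) (at x)"
    using assms by (auto simp: differentiable_def)
  interpret D: bounded_linear D using D by (rule has_derivative_bounded_linear)
  \<comment> \<open>the vector representing the derivative is its adjoint applied to 1\<close>
  have "D k = k \<bullet> adjoint D 1" for k
    using adjoint_works[OF D.linear, of k 1] by simp
  then have "D = (\<lambda>k. k \<bullet> adjoint D 1)" by blast
  with D have ex: "GDERIV f x :> adjoint D 1" by (simp add: gderiv_def)
  have "d = d'" if "GDERIV f x :> d" "GDERIV f x :> d'" for d d'
  proof -
    have "(\<lambda>k. k \<bullet> d) = (\<lambda>k. k \<bullet> d')"
      using that has_derivative_unique unfolding gderiv_def by blast
    then show ?thesis by (metis vector_eq_ldot)
  qed
  with ex show ?thesis unfolding gradient_def by (metis theI)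
qed

lemma hessian_symmetric:
  assumes "twice_continuously_differentiable f"
  shows "a \<bullet> (hessian f x *v b) = b \<bullet> (hessian f x *v a)"
proof (rule symmetric_second_derivative)
  show "GDERIV f y :> gradient f y" for y
    using assms by (simp add: twice_continuously_differentiable_def gderiv_gradient)
  show "(gradient f has_derivative (\<lambda>v. hessian f x *v v)) (at x)"
    using assms jacobian_works[of "gradient f" "at x"]
    by (simp add: twice_continuously_differentiable_def hessian_def)
qed

section \<open>Linear functionals on an ellipsoid\<close>

lemma arg_max_on_ellipsoid:
  fixes W :: "real^'n^'n"
  assumes sym: "\<And>a b. a \<bullet> (W *v b) = b \<bullet> (W *v a)"
    and pd: "pos_def_matrix W" and "\<xi> \<noteq> 0" "0 < \<delta>"
    and u: "is_arg_max (\<lambda>v. \<xi> \<bullet> (W *v v)) (\<lambda>v. v \<bullet> (W *v v) \<le> \<delta>) u"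
  shows "\<exists>s>0. u = s *\<^sub>R \<xi>"
proof -
  have c: "0 < \<xi> \<bullet> (W *v \<xi>)" using pd \<open>\<xi> \<noteq> 0\<close> by (simp add: pos_def_matrix_def)
  \<comment> \<open>the scaling that puts the multiple of the objective vector on the boundary\<close>
  define s where "s = sqrt (\<delta> / (\<xi> \<bullet> (W *v \<xi>)))"
  have s: "0 < s" "s * (s * (\<xi> \<bullet> (W *v \<xi>))) = \<delta>"
    using c \<open>0 < \<delta>\<close> by (simp_all add: s_def flip: mult.assoc)
  let ?v = "s *\<^sub>R \<xi>"
  have v: "?v \<bullet> (W *v ?v) = \<delta>"
    using s by (simp add: matrix_vector_mult_scaleR)
  have "\<xi> \<bullet> (W *v ?v) \<le> \<xi> \<bullet> (W *v u)"
    using u v unfolding is_arg_max_def by (metis linorder_not_less order_refl)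
  then have "?v \<bullet> (W *v ?v) \<le> ?v \<bullet> (W *v u)"
    using s by simp
  moreover have "u \<bullet> (W *v u) \<le> \<delta>" using u by (simp add: is_arg_max_def)
  \<comment> \<open>both vectors lie in the ellipsoid and \<open>\<langle>v, W u\<rangle> \<ge> \<delta>\<close>, which forces them to coincide\<close>
  moreover have "(u - ?v) \<bullet> (W *v (u - ?v))
      = u \<bullet> (W *v u) - 2 * (?v \<bullet> (W *v u)) + ?v \<bullet> (W *v ?v)"
    using sym[of u ?v]
    by (simp only: matrix_vector_mult_diff_distrib inner_diff_left inner_diff_right)
  ultimately have "(u - ?v) \<bullet> (W *v (u - ?v)) \<le> 0" using v by linarith
  then have "u - ?v = 0"
    using pd unfolding pos_def_matrix_def by (metis linorder_not_less)
  then show ?thesis using s by auto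
qed

section \<open>The maximum of the block forms\<close>

lemma offset_zero [simp]: "offset ns 0 = 0"
  by (simp add: offset_def)

lemma coord_surj:
  fixes c :: "'n::{finite,linorder}"
  assumes ns: "sum_list ns = CARD('n)"
  shows "\<exists>i<length ns. \<exists>j<ns ! i. coord ns i j = c"
proof -
  let ?xs = "sorted_list_of_set (UNIV :: 'n set)"
  have "c \<in> set ?xs" by simp
  then obtain p where p: "p < CARD('n)" "?xs ! p = c"
    by (metis in_set_conv_nth length_sorted_list_of_set)
  have "p < offset ns (length ns)" using p ns by (simp add: offset_def)
  \<comment> \<open>the block containing position \<open>p\<close> precedes the first block boundary beyond \<open>p\<close>\<close>
  then obtain k where k: "k \<le> length ns" "p < offset ns k" "\<And>i. i < k \<Longrightarrow> \<not> p < offset ns i"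
    using ex_least_nat_le[of "\<lambda>k. p < offset ns k" "length ns"] by auto
  then obtain i where i: "k = Suc i" by (cases k) auto
  have "i < length ns" "offset ns i \<le> p" "p < offset ns i + ns ! i"
    using k i by (auto simp: offset_Suc not_less)
  then show ?thesis
    using p by (intro exI[of _ i] conjI exI[of _ "p - offset ns i"]) (auto simp: coord_def)
qed

lemma V_max_pos:
  fixes l :: "real^'n::{finite,linorder}"
  assumes ns: "sum_list ns = CARD('n)"
    and Q: "\<And>i. i < length ns \<Longrightarrow> sym_pos_def (ns ! i) (Q i)"
    and "l \<noteq> 0"
  shows "0 < V_max ns Q l"
proof -
  obtain c where "l $ c \<noteq> 0" using \<open>l \<noteq> 0\<close> by (auto simp: vec_eq_iff)
  moreover obtain i j where ij: "i < length ns" "j < ns ! i" "coord ns i j = c"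
    using coord_surj[OF ns] by blast
  ultimately have "\<exists>j<ns ! i. l $ coord ns i j \<noteq> 0" by blast
  then have "0 < (\<Sum>j<ns!i. \<Sum>k<ns!i. l $ coord ns i j * Q i j k * l $ coord ns i k)"
    using Q[OF ij(1), unfolded sym_pos_def_def, THEN conjunct2,
        THEN spec[of _ "\<lambda>j. l $ coord ns i j"]] by (rule mp[rotated])
  then have "0 < V_block ns Q i l" by (simp add: V_block_def)
  also have "\<dots> \<le> V_max ns Q l" using ij by (simp add: V_max_def)
  finally show ?thesis .
qed

lemma V_max_zero:
  assumes "ns \<noteq> []"
  shows "V_max ns Q (0 :: real^'n::{finite,linorder}) = 0"
proof -
  have "(\<lambda>i. V_block ns Q i (0 :: real^'n::{finite,linorder})) ` {..<length ns} = {0}"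
    using assms by (auto simp: V_block_def)
  then show ?thesis by (simp add: V_max_def)
qed

lemma unbiased_subgradient_nonzero:
  fixes l :: "real^'n::{finite,linorder}"
  assumes ns: "sum_list ns = CARD('n)"
    and Q: "\<And>i. i < length ns \<Longrightarrow> sym_pos_def (ns ! i) (Q i)"
    and \<xi>: "unbiased_subgradient ns Q l \<xi>"
  shows "\<xi> \<noteq> 0"
proof
  assume "\<xi> = 0"
  then have "V_max ns Q l \<le> V_max ns Q (0 :: real^'n::{finite,linorder})"
    using \<xi> unfolding unbiased_subgradient_def subdifferential_def by force
  moreover have "ns \<noteq> []" using ns by auto
  moreover have "0 < V_max ns Q l"
    using V_max_pos[OF ns Q] \<xi> by (simp add: unbiased_subgradient_def)
  ultimately show False by (simp add: V_max_zero)
qed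

section \<open>The maximum principle as block coordinate descent\<close>

theorem proposition3:
  fixes E :: "real^'n::{finite,linorder} \<Rightarrow> real"
    and \<Delta> :: "real^'n::{finite,linorder} \<Rightarrow> real"
    and ns :: "nat list"
    and Q :: "nat \<Rightarrow> nat \<Rightarrow> nat \<Rightarrow> real"
    and \<nu>\<^sub>0 :: real
    and h :: "nat \<Rightarrow> real"
    and x u \<xi> lam :: "nat \<Rightarrow> real^'n::{finite,linorder}"
  assumes "strictly_convex_on UNIV E"
    and "twice_continuously_differentiable E"
    and "\<And>y. pos_def_matrix (hessian E y)"
    and "\<And>y. 0 < \<Delta> y"
    and "\<And>i. i < length ns \<Longrightarrow> 1 \<le> ns ! i"
    and "sum_list ns = CARD('n)"
    and "\<And>i. i < length ns \<Longrightarrow> sym_pos_def (ns ! i) (Q i)"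
    and "0 < \<nu>\<^sub>0"
    and "\<And>k. 0 < h k"
    and "\<And>k. x (Suc k) = x k + h k *\<^sub>R u k"
    and "\<And>k. lam k = - \<nu>\<^sub>0 *\<^sub>R gradient E (x k)"
    and "\<And>k. gradient E (x k) \<noteq> 0 \<Longrightarrow> unbiased_subgradient ns Q (lam k) (\<xi> k)"
    and "\<And>k. gradient E (x k) \<noteq> 0 \<Longrightarrow>
           is_arg_max (\<lambda>v. \<xi> k \<bullet> (hessian E (x k) *v v)) (\<lambda>v. v \<in> control_set E \<Delta> (x k)) (u k)"
  shows "\<forall>k. gradient E (x k) \<noteq> 0 \<longrightarrow>
           (\<exists>\<alpha>>0. x (Suc k) = x k - \<alpha> *\<^sub>R
              (q_vec ns Q (lam k) * (block_diag ns Q *v gradient E (x k))))"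
proof (intro allI impI)
  fix k assume nz: "gradient E (x k) \<noteq> 0"
  note \<xi> = assms(12)[OF nz]
  let ?d = "q_vec ns Q (lam k) * (block_diag ns Q *v gradient E (x k))"
  have "\<xi> k \<noteq> 0"
    using unbiased_subgradient_nonzero[OF assms(6,7) \<xi>] .
  then obtain s where s: "0 < s" "u k = s *\<^sub>R \<xi> k"
    using arg_max_on_ellipsoid[OF hessian_symmetric[OF assms(2)] assms(3) _ assms(4)]
      assms(13)[OF nz] unfolding control_set_def mem_Collect_eq by blast
  obtain \<gamma> where \<gamma>: "0 < \<gamma>" "\<xi> k = \<gamma> *\<^sub>R (q_vec ns Q (lam k) * (block_diag ns Q *v lam k))"
    using \<xi> by (auto simp: unbiased_subgradient_def)
  have "block_diag ns Q *v lam k = - \<nu>\<^sub>0 *\<^sub>R (block_diag ns Q *v gradient E (x k))"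
    unfolding assms(11) by (rule matrix_vector_mult_scaleR)
  then have "\<xi> k = \<gamma> *\<^sub>R (q_vec ns Q (lam k) * (- \<nu>\<^sub>0 *\<^sub>R (block_diag ns Q *v gradient E (x k))))"
    using \<gamma>(2) by simp
  also have "\<dots> = - (\<gamma> * \<nu>\<^sub>0) *\<^sub>R ?d"
    by (simp add: vec_eq_iff)
  finally have "x (Suc k) = x k - (h k * s * \<gamma> * \<nu>\<^sub>0) *\<^sub>R ?d"
    using assms(10)[of k] s(2) by (simp add: mult.assoc)
  moreover have "0 < h k * s * \<gamma> * \<nu>\<^sub>0"
    using assms(8) assms(9)[of k] s(1) \<gamma>(1) by simp
  ultimately show "\<exists>\<alpha>>0. x (Suc k) = x k - \<alpha> *\<^sub>R ?d" by blast
qed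

end
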